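(* Let $b^{\ast}>0$, let $I\subset[0,b^{\ast}]$ be an interval with interior $I^{\circ}$, and let $f:I\to\mathbb{R}$ be a twice differentiable mapping on $I^{\circ}$ such that $f''\in L[a,b]$, where $a,b\in I$ with $a<b$. If $|f''|^{q}$ is $(\alpha,m)$-convex on $[a,b]$ for $(\alpha,m)\in[0,1]^2$, $q\ge 1$, then the following inequality holds: $$\left|\frac{f(a)+f(mb)}{2}-\frac{1}{mb-a}\int_{a}^{mb}f(x)\,dx\right|\le\frac{(mb-a)^2}{8}\left(\frac{\Gamma(1+p)}{\Gamma\left(\frac32+p\right)}\right)^{\frac1p}\left(|f''(a)|^{q}\frac{1}{\alpha+1}+m|f''(b)|^{q}\left(\frac{\alpha}{\alpha+1}\right)\right)^{\frac1q},$$ where $\frac1p+\frac1q=1$.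
   Context: $\Gamma(x)=\int_0^\infty e^{-t}t^{x-1}\,dt$, $x>0$, is the Gamma function, and $L[a,b]$ denotes the space of integrable functions on $[a,b]$. For $(\alpha,m)\in[0,1]^2$, a function $g:[0,b]\to\mathbb{R}$ is said to be $(\alpha,m)$-convex if $g(tx+m(1-t)y)\le t^{\alpha}g(x)+m(1-t^{\alpha})g(y)$ for every $x,y\in[0,b]$ and $t\in[0,1]$; "$(\alpha,m)$-convex on $[a,b]$" refers to the same inequality with $x,y\in[a,b]$ and $t\in[0,1]$. *)

theory Defs
  imports "HOL-Analysis.Analysis"
begin

text \<open>
  The power \<open>t\<^sup>\<alpha>\<close> for \<open>t, \<alpha> \<ge> 0\<close> with the usual convention \<open>0\<^sup>0 = 1\<close>, whereas
  \<open>0 powr 0 = 0\<close>.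
\<close>

definition rpow :: "real \<Rightarrow> real \<Rightarrow> real" where
  "rpow t \<alpha> = (if \<alpha> = 0 then 1 else t powr \<alpha>)"

text \<open>
  The points \<open>t * x + m * (1 - t) * y\<close> range over \<open>[m * a, b]\<close> when \<open>S = {a..b}\<close>, so the
  inequality also involves values of \<open>g\<close> outside \<open>S\<close>.
\<close>

definition alpha_m_convex_on :: "real \<Rightarrow> real \<Rightarrow> real set \<Rightarrow> (real \<Rightarrow> real) \<Rightarrow> bool" where
  "alpha_m_convex_on \<alpha> m S g \<longleftrightarrow>
     (\<forall>x\<in>S. \<forall>y\<in>S. \<forall>t\<in>{0..1}.
        g (t * x + m * (1 - t) * y) \<le> rpow t \<alpha> * g x + m * (1 - rpow t \<alpha>) * g y)"

text \<open>
  The exponent is extended real because \<open>1 / p + 1 / q = 1\<close> with \<open>q = 1\<close> means \<open>p = \<infinity>\<close>;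
  the value there is the limit of the values at finite exponents.
\<close>

definition gamma_ratio_root :: "ereal \<Rightarrow> real" where
  "gamma_ratio_root p =
     (let h = (\<lambda>r::real. (Gamma (1 + r) / Gamma (3 / 2 + r)) powr (1 / r))
      in if p = \<infinity> then Lim at_top h else h (real_of_ereal p))"

end

theory Submission
  imports Defs "HOL-Real_Asymp.Real_Asymp"
begin

text \<open>
  Put \<open>c = m * b\<close>.  Integrating by parts twice turns the trapezoid error into a weighted mean
  of the second derivative,
  \<open>(f a + f c) / 2 - 1 / (c - a) * (LBINT x=a..c. f x) = (c - a)\<^sup>2 / 2 * K\<close>, where \<open>K\<close> is the
  integral over \<open>{0..1}\<close> of \<open>t * (1 - t) * f'' (t * a + (1 - t) * c)\<close>
  (\<open>has_integral_trapezoid_error\<close>).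

  Convexity, applied with \<open>x = a\<close> and \<open>y = b\<close>, says that at the point
  \<open>t * a + (1 - t) * c\<close> the function \<open>\<bar>f''\<bar> powr q\<close> is at most
  \<open>\<phi> t = rpow t \<alpha> * \<bar>f'' a\<bar> powr q + m * (1 - rpow t \<alpha>) * \<bar>f'' b\<bar> powr q\<close>.  The integral of \<open>\<phi>\<close>
  over \<open>{0..1}\<close> is the bracket on the right-hand side of the theorem.  Hence \<open>K\<close> can be estimated
  by the Hoelder inequality with \<open>\<phi> powr (1 / q)\<close> in place of \<open>\<bar>f''\<bar>\<close>
  (\<open>has_integral_Holder_bound\<close>).

  The other factor is the integral of \<open>(t * (1 - t)) powr p\<close>, a Beta value.  By the duplication
  formula it equals \<open>sqrt pi / 2 * (1 / 4) powr p * (Gamma (1 + p) / Gamma (3 / 2 + p))\<close>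
  (\<open>has_integral_Beta_diagonal\<close>), and since \<open>sqrt pi \<le> 2\<close> its \<open>p\<close>-th root is at most
  \<open>1 / 4 * gamma_ratio_root p\<close>.  For \<open>q = 1\<close> the pointwise bound \<open>t * (1 - t) \<le> 1 / 4\<close> takes its
  place, which matches the formula because \<open>gamma_ratio_root\<close> is \<open>1\<close> at infinity
  (\<open>gamma_ratio_root_infinity\<close>).
\<close>

section \<open>The trapezoid error as a weighted integral of the second derivative\<close>

text \<open>
  Two integrations by parts, packed into one antiderivative, so that the fundamental theorem of
  calculus yields the existence of the integral together with its value.  Either order of
  \<open>a\<close> and \<open>c\<close> is allowed, because \<open>m * b\<close> may lie on either side of \<open>a\<close>.
\<close>

lemma has_integral_trapezoid_error:
  fixes f f' f'' :: "real \<Rightarrow> real" and a c :: real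
  assumes "a \<noteq> c"
    and f: "\<And>x. x \<in> closed_segment a c \<Longrightarrow>
              (f has_real_derivative f' x) (at x within closed_segment a c)"
    and f': "\<And>x. x \<in> closed_segment a c \<Longrightarrow>
              (f' has_real_derivative f'' x) (at x within closed_segment a c)"
  shows "((\<lambda>t. t * (1 - t) * f'' (t * a + (1 - t) * c)) has_integral
           2 / (c - a)\<^sup>2 * ((f a + f c) / 2 - 1 / (c - a) * (LBINT x=a..c. f x))) {0..1}"
proof -
  let ?S = "closed_segment a c"
  have S: "?S = {min a c..max a c}"
    by (simp add: closed_segment_eq_real_ivl min_def max_def)
  have contf: "continuous_on ?S f"
    using f by (meson DERIV_continuous continuous_on_eq_continuous_within)
  obtain F where F: "\<And>x. x \<in> ?S \<Longrightarrow> (F has_vector_derivative f x) (at x within ?S)"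
    using antiderivative_continuous[of "min a c" "max a c" f] contf unfolding S by blast
  have L: "(LBINT x=a..c. f x) = F c - F a"
    using contf F unfolding S by (intro interval_integral_FTC_finite) auto
  define d where "d = a - c"
  have d: "d \<noteq> 0"
    using \<open>a \<noteq> c\<close> by (simp add: d_def)
  define X where "X = (\<lambda>t. t * a + (1 - t) * c)"
  have X_in: "X t \<in> ?S" if "t \<in> {0..1}" for t
    using that unfolding X_def closed_segment_def
    by (auto intro!: exI[of _ "1 - t"])
  have dX: "(X has_real_derivative d) (at t within {0..1})" for t
    unfolding X_def d_def by (auto intro!: derivative_eq_intros)
  have chain: "((\<lambda>t. g (X t)) has_real_derivative g' (X t) * d) (at t within {0..1})"
    if "\<And>x. x \<in> ?S \<Longrightarrow> (g has_real_derivative g' x) (at x within ?S)" "t \<in> {0..1}"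
    for g g' :: "real \<Rightarrow> real" and t
  proof -
    have "(g has_real_derivative g' (X t)) (at (X t) within X ` {0..1})"
      using that X_in by (intro DERIV_subset[OF that(1)]) auto
    from DERIV_image_chain[OF this dX] show ?thesis
      by (simp add: o_def)
  qed
  have F': "\<And>x. x \<in> ?S \<Longrightarrow> (F has_real_derivative f x) (at x within ?S)"
    using F by (simp add: has_real_derivative_iff_has_vector_derivative)
  \<comment> \<open>The last term has derivative \<open>- 2 * f (X t) / d\<^sup>2\<close>, cancelling what the first two leave over.\<close>
  define H where "H = (\<lambda>t. t * (1 - t) * f' (X t) / d - (1 - 2 * t) * f (X t) / d\<^sup>2
                             - 2 * F (X t) / d ^ 3)"
  have dH: "(H has_real_derivative t * (1 - t) * f'' (X t)) (at t within {0..1})"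
    if t: "t \<in> {0..1}" for t
  proof -
    have "((\<lambda>t. f' (X t)) has_real_derivative f'' (X t) * d) (at t within {0..1})"
         "((\<lambda>t. f (X t)) has_real_derivative f' (X t) * d) (at t within {0..1})"
         "((\<lambda>t. F (X t)) has_real_derivative f (X t) * d) (at t within {0..1})"
      by (rule chain[OF f' t] chain[OF f t] chain[OF F' t]; assumption)+
    then show ?thesis
      unfolding H_def using d
      by (auto intro!: derivative_eq_intros simp: field_simps power2_eq_square power3_eq_cube)
  qed
  have "((\<lambda>t. t * (1 - t) * f'' (X t)) has_integral (H 1 - H 0)) {0..1}"
    using dH
    by (intro fundamental_theorem_of_calculus)
       (auto simp: has_real_derivative_iff_has_vector_derivative)
  moreover have "H 1 - H 0 = 2 / (c - a)\<^sup>2 * ((f a + f c) / 2 - 1 / (c - a) * (F c - F a))"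
  proof -
    have ca: "c - a = - d"
      by (simp add: d_def)
    show ?thesis
      unfolding H_def X_def ca using d by (simp add: field_simps power2_eq_square power3_eq_cube)
  qed
  ultimately show ?thesis
    by (simp add: L X_def)
qed


section \<open>Hoelder's inequality against a majorant\<close>

text \<open>
  The \<open>q\<close>-th power in Hoelder's inequality is replaced by a majorant \<open>\<phi>\<close>, since the convexity
  hypothesis bounds \<open>\<bar>f''\<bar> powr q\<close> by a function that can be integrated explicitly.
  Young's inequality bounds \<open>u * \<phi> powr (1 / q)\<close>, normalised, by a combination of \<open>u powr p\<close>
  and \<open>\<phi>\<close>, and this combination is integrated.  Enlarging both integrals by \<open>e > 0\<close> makes the
  normalisation possible when one of them vanishes.
\<close>

lemma has_integral_Holder_bound:
  fixes u \<phi> k :: "'a::euclidean_space \<Rightarrow> real" and p q :: real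
  assumes p: "p > 1" and q: "q > 1" and pq: "1 / p + 1 / q = 1"
    and u: "\<And>x. x \<in> S \<Longrightarrow> u x \<ge> 0" and \<phi>: "\<And>x. x \<in> S \<Longrightarrow> \<phi> x \<ge> 0"
    and U: "((\<lambda>x. u x powr p) has_integral U) S" and \<Phi>: "(\<phi> has_integral \<Phi>) S"
    and K: "(k has_integral K) S"
    and k: "\<And>x. x \<in> S \<Longrightarrow> \<bar>k x\<bar> \<le> u x * \<phi> x powr (1 / q)"
  shows "\<bar>K\<bar> \<le> U powr (1 / p) * \<Phi> powr (1 / q)"
proof -
  have U0: "U \<ge> 0" and \<Phi>0: "\<Phi> \<ge> 0"
    using has_integral_nonneg[OF U] has_integral_nonneg[OF \<Phi>] \<phi> by auto
  have bound: "\<bar>K\<bar> \<le> (U + e) powr (1 / p) * (\<Phi> + e) powr (1 / q)" if e: "e > 0" for e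
  proof -
    define A where "A = (U + e) powr (1 / p)"
    define B where "B = (\<Phi> + e) powr (1 / q)"
    have A: "A > 0" "A powr p = U + e" and B: "B > 0" "B powr q = \<Phi> + e"
      using e U0 \<Phi>0 p q by (auto simp: A_def B_def powr_powr)
    let ?g = "\<lambda>x. A * B * (u x powr p * (1 / (p * (U + e))) + \<phi> x * (1 / (q * (\<Phi> + e))))"
    have g: "(?g has_integral
        A * B * (U * (1 / (p * (U + e))) + \<Phi> * (1 / (q * (\<Phi> + e))))) S"
      by (intro has_integral_mult_right has_integral_add has_integral_mult_left U \<Phi>)
    have kg: "norm (k x) \<le> ?g x" if x: "x \<in> S" for x
    proof -
      have "(u x / A) * (\<phi> x powr (1 / q) / B)
          \<le> (u x / A) powr p / p + (\<phi> x powr (1 / q) / B) powr q / q"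
        using p q pq u[OF x] A B by (intro Youngs_inequality) auto
      also have "\<dots> = u x powr p * (1 / (p * (U + e))) + \<phi> x * (1 / (q * (\<Phi> + e)))"
        using u[OF x] \<phi>[OF x] A B q by (simp add: powr_divide powr_powr field_simps)
      finally have "A * B * ((u x / A) * (\<phi> x powr (1 / q) / B)) \<le> ?g x"
        using A B by (intro mult_left_mono) auto
      then show ?thesis
        using k[OF x] A B by simp
    qed
    have "\<bar>K\<bar> \<le> A * B * (U * (1 / (p * (U + e))) + \<Phi> * (1 / (q * (\<Phi> + e))))"
    proof -
      have "norm (integral S k) \<le> integral S ?g"
        using K g kg by (intro integral_norm_bound_integral) auto
      then show ?thesis
        using integral_unique[OF K] integral_unique[OF g] by (simp only: real_norm_def)
    qed
    also have "\<dots> \<le> A * B * (1 / p + 1 / q)"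
    proof (intro mult_left_mono add_mono)
      show "U * (1 / (p * (U + e))) \<le> 1 / p"
        using e U0 p divide_right_mono[of "U / (U + e)" 1 p] by (simp add: mult.commute)
      show "\<Phi> * (1 / (q * (\<Phi> + e))) \<le> 1 / q"
        using e \<Phi>0 q divide_right_mono[of "\<Phi> / (\<Phi> + e)" 1 q] by (simp add: mult.commute)
    qed (use A B in auto)
    finally show ?thesis
      using pq by (simp add: A_def B_def)
  qed
  have "((\<lambda>e. (U + e) powr (1 / p) * (\<Phi> + e) powr (1 / q)) \<longlongrightarrow>
          (U + 0) powr (1 / p) * (\<Phi> + 0) powr (1 / q)) (at_right 0)"
  proof (intro tendsto_intros disjI2 conjI)
    show "\<forall>\<^sub>F e in at_right 0. 0 \<le> U + e" "\<forall>\<^sub>F e in at_right 0. 0 \<le> \<Phi> + e"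
      using U0 \<Phi>0 by (auto simp: eventually_at intro!: exI[of _ 1])
  qed (use p q in auto)
  moreover have "\<forall>\<^sub>F e in at_right 0. \<bar>K\<bar> \<le> (U + e) powr (1 / p) * (\<Phi> + e) powr (1 / q)"
    using bound by (auto simp: eventually_at intro!: exI[of _ 1])
  ultimately show ?thesis
    using tendsto_lowerbound[of _ _ "at_right (0::real)"] by fastforce
qed


section \<open>The Gamma function factor\<close>

lemma Gamma_legendre_duplication_real:
  fixes z :: real
  assumes "z > 0"
  shows "Gamma z * Gamma (z + 1 / 2) = 2 powr (1 - 2 * z) * sqrt pi * Gamma (2 * z)"
proof -
  have nz: "complex_of_real x \<notin> \<int>\<^sub>\<le>\<^sub>0" if "x > 0" for x
    using that by (auto elim!: nonpos_Ints_cases' simp: complex_eq_iff)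
  have "complex_of_real (Gamma z * Gamma (z + 1 / 2)) =
        complex_of_real (exp ((1 - 2 * z) * ln 2) * sqrt pi * Gamma (2 * z))"
    using Gamma_legendre_duplication[of "complex_of_real z"] nz[of z] nz[of "z + 1 / 2"] assms
    by (simp add: exp_of_real[symmetric] Gamma_complex_of_real[symmetric])
  then show ?thesis
    by (simp only: of_real_eq_iff powr_def) simp
qed

text \<open>
  The integral is \<open>Beta (p + 1) (p + 1)\<close>, whose denominator \<open>Gamma (2 * p + 2)\<close> the duplication
  formula splits; this is the origin of the quotient of Gamma values at distance \<open>1 / 2\<close>.
\<close>

lemma has_integral_Beta_diagonal:
  fixes p :: real
  assumes "p > 0"
  shows "((\<lambda>t. (t * (1 - t)) powr p) has_integral
           (sqrt pi / 2 * (1 / 4) powr p * (Gamma (1 + p) / Gamma (3 / 2 + p)))) {0..1}"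
proof -
  have "((\<lambda>t. t powr (p + 1 - 1) * (1 - t) powr (p + 1 - 1)) has_integral Beta (p + 1) (p + 1))
          {0..1}"
    using assms by (intro has_integral_Beta_real) auto
  then have "((\<lambda>t. (t * (1 - t)) powr p) has_integral Beta (p + 1) (p + 1)) {0..1}"
    by (rule has_integral_eq[rotated]) (auto simp: powr_mult)
  moreover have "Beta (p + 1) (p + 1) =
      sqrt pi / 2 * (1 / 4) powr p * (Gamma (1 + p) / Gamma (3 / 2 + p))"
  proof -
    have pos: "Gamma (1 + p) > 0" "Gamma (3 / 2 + p) > 0" "Gamma (2 * p + 2) > 0"
      using assms by (auto intro!: Gamma_real_pos)
    have dup: "Gamma (1 + p) * Gamma (3 / 2 + p) = 2 powr (- 1 - 2 * p) * sqrt pi * Gamma (2 * p + 2)"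
      using Gamma_legendre_duplication_real[of "1 + p"] assms by (simp add: algebra_simps)
    have "2 powr (- 1 - 2 * p) = (1 / 2) * (1 / 4 :: real) powr p"
    proof -
      have "(4::real) powr p = 2 powr (2 * p)"
        using powr_powr[of "2::real" 2 p] by (simp add: powr_numeral)
      then show ?thesis
        by (simp add: powr_diff powr_minus powr_divide field_simps)
    qed
    with dup have "Gamma (1 + p) * Gamma (3 / 2 + p)
        = sqrt pi / 2 * (1 / 4) powr p * Gamma (2 * p + 2)"
      by simp
    then show ?thesis
      using pos unfolding Beta_def by (simp add: field_simps)
  qed
  ultimately show ?thesis
    by simp
qed

text \<open>Log-convexity of \<open>Gamma\<close> at the midpoint of \<open>x\<close> and \<open>x + 1\<close>.\<close>

lemma Gamma_plus_half_le:
  fixes x :: real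
  assumes "x > 0"
  shows "Gamma (x + 1 / 2) \<le> sqrt x * Gamma x"
proof -
  have pos: "Gamma x > 0" "Gamma (x + 1 / 2) > 0" "Gamma (x + 1) > 0"
    using assms by (auto intro!: Gamma_real_pos)
  have Suc: "Gamma (x + 1) = x * Gamma x"
    using assms by (intro Gamma_plus1) (auto elim!: nonpos_Ints_cases')
  have mid: "(1 - 1 / 2) *\<^sub>R x + (1 / 2) *\<^sub>R (x + 1) = x + 1 / 2"
    by (simp add: field_simps)
  have "(ln \<circ> Gamma) ((1 - 1 / 2) *\<^sub>R x + (1 / 2) *\<^sub>R (x + 1))
      \<le> (1 - 1 / 2) * (ln \<circ> Gamma) x + 1 / 2 * (ln \<circ> Gamma) (x + 1)"
    using assms by (intro convex_onD[OF log_convex_Gamma_real]) auto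
  then have "ln (Gamma (x + 1 / 2)) \<le> ln (Gamma x) / 2 + ln (x * Gamma x) / 2"
    unfolding mid o_def Suc by simp
  also have "\<dots> = ln (sqrt x * Gamma x)"
    using assms pos by (simp add: ln_mult ln_sqrt field_simps)
  finally show ?thesis
    using assms pos by simp
qed

text \<open>
  For \<open>r \<ge> 1\<close> the quotient lies between \<open>(1 + r) powr (- 1 / 2)\<close> and \<open>1\<close>, and the \<open>r\<close>-th root of a
  power of \<open>r\<close> tends to \<open>1\<close>.
\<close>

lemma gamma_ratio_root_infinity: "gamma_ratio_root \<infinity> = 1"
proof -
  let ?h = "\<lambda>r::real. (Gamma (1 + r) / Gamma (3 / 2 + r)) powr (1 / r)"
  have lim: "((\<lambda>r::real. ((1 + r) powr (- 1 / 2)) powr (1 / r)) \<longlongrightarrow> 1) at_top"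
    by real_asymp
  have "(?h \<longlongrightarrow> 1) at_top"
  proof (rule tendsto_sandwich[OF _ _ lim tendsto_const])
    show "\<forall>\<^sub>F r in at_top. ((1 + r) powr (- 1 / 2)) powr (1 / r) \<le> ?h r"
      using eventually_ge_at_top[of 1]
    proof eventually_elim
      case (elim r)
      have pos: "Gamma (1 + r) > 0" "Gamma (3 / 2 + r) > 0"
        using elim by (auto intro!: Gamma_real_pos)
      have "Gamma (3 / 2 + r) \<le> sqrt (1 + r) * Gamma (1 + r)"
        using Gamma_plus_half_le[of "1 + r"] elim by (simp add: add_ac)
      then have "(1 + r) powr (- 1 / 2) \<le> Gamma (1 + r) / Gamma (3 / 2 + r)"
        using pos elim by (simp add: powr_minus_divide powr_half_sqrt field_simps)
      then show ?case
        using elim by (intro powr_mono2) auto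
    qed
    show "\<forall>\<^sub>F r in at_top. ?h r \<le> 1"
      using eventually_ge_at_top[of 1]
    proof eventually_elim
      case (elim r)
      have pos: "Gamma (1 + r) > 0" "Gamma (3 / 2 + r) > 0" "Gamma (1 / 2 + r) > 0"
        using elim by (auto intro!: Gamma_real_pos)
      have "Gamma (1 + r) \<le> sqrt (1 / 2 + r) * Gamma (1 / 2 + r)"
        using Gamma_plus_half_le[of "1 / 2 + r"] elim by (simp add: add_ac)
      also have "\<dots> \<le> (1 / 2 + r) * Gamma (1 / 2 + r)"
      proof (intro mult_right_mono)
        show "sqrt (1 / 2 + r) \<le> 1 / 2 + r"
          using elim mult_mono[of 1 r 1 r]
          by (intro real_le_lsqrt) (auto simp: power2_eq_square algebra_simps)
      qed (use pos in auto)
      also have "\<dots> = Gamma (3 / 2 + r)"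
      proof -
        have "1 / 2 + r \<notin> \<int>\<^sub>\<le>\<^sub>0"
          using elim by (auto elim!: nonpos_Ints_cases')
        from Gamma_plus1[OF this] show ?thesis
          by (simp add: add_ac)
      qed
      finally have "Gamma (1 + r) / Gamma (3 / 2 + r) \<le> 1"
        using pos by simp
      then have "?h r \<le> 1 powr (1 / r)"
        using pos elim by (intro powr_mono2) auto
      then show ?case
        by simp
    qed
  qed
  then show ?thesis
    unfolding gamma_ratio_root_def Let_def by (simp add: tendsto_Lim)
qed

text \<open>
  For finite \<open>p\<close> the power integral contributes a further factor \<open>(sqrt pi / 2) powr (1 / p)\<close>,
  which is at most \<open>1\<close>.  For infinite \<open>p\<close> the maximum \<open>1 / 4\<close> of \<open>t * (1 - t)\<close> replaces
  the \<open>p\<close>-th root of that integral.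
\<close>

lemma quadratic_weight_Holder_bound:
  fixes \<phi> k :: "real \<Rightarrow> real" and p :: ereal and q :: real
  assumes q: "q \<ge> 1" and p: "p \<ge> 1" and pq: "1 / p + 1 / ereal q = 1"
    and \<phi>: "\<And>t. t \<in> {0..1} \<Longrightarrow> \<phi> t \<ge> 0" and \<Phi>: "(\<phi> has_integral \<Phi>) {0..1}"
    and K: "(k has_integral K) {0..1}"
    and k: "\<And>t. t \<in> {0..1} \<Longrightarrow> \<bar>k t\<bar> \<le> t * (1 - t) * \<phi> t powr (1 / q)"
  shows "\<bar>K\<bar> \<le> 1 / 4 * gamma_ratio_root p * \<Phi> powr (1 / q)"
proof -
  have \<Phi>0: "\<Phi> \<ge> 0"
    using has_integral_nonneg[OF \<Phi>] \<phi> by auto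
  consider (infinite) "p = \<infinity>" | (finite) r where "p = ereal r" "r \<ge> 1"
    using p by (cases p) auto
  then show ?thesis
  proof cases
    case infinite
    then have q1: "q = 1"
      using pq q by (simp add: one_ereal_def)
    have "\<bar>k t\<bar> \<le> 1 / 4 * \<phi> t" if t: "t \<in> {0..1}" for t
    proof -
      have "t * (1 - t) \<le> 1 / 4"
        using zero_le_power2[of "t - 1 / 2"] by (simp add: power2_eq_square algebra_simps)
      then show ?thesis
        using k[OF t] \<phi>[OF t] mult_right_mono[of "t * (1 - t)" "1 / 4" "\<phi> t"] q1 by simp
    qed
    then have "\<bar>K\<bar> \<le> 1 / 4 * \<Phi>"
      using integral_norm_bound_integral[of k "{0..1}" "\<lambda>t. 1 / 4 * \<phi> t"] K
        has_integral_mult_right[OF \<Phi>, of "1 / 4"]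
      by (auto simp: has_integral_iff)
    then show ?thesis
      using infinite q1 \<Phi>0 gamma_ratio_root_infinity by simp
  next
    case finite
    have rq: "1 / r + 1 / q = 1"
      using pq finite q by (simp add: one_ereal_def)
    then have "r \<noteq> 1" "q \<noteq> 1"
      using finite q by auto
    then have r1: "r > 1" and q1: "q > 1"
      using finite q by auto
    define R where "R = Gamma (1 + r) / Gamma (3 / 2 + r)"
    have R: "R > 0"
      unfolding R_def using r1 by (intro divide_pos_pos Gamma_real_pos) auto
    have "\<bar>K\<bar> \<le> (sqrt pi / 2 * (1 / 4) powr r * R) powr (1 / r) * \<Phi> powr (1 / q)"
      by (rule has_integral_Holder_bound[OF r1 q1 rq _ \<phi> _ \<Phi> K k])
         (use has_integral_Beta_diagonal[of r] r1 in \<open>auto simp: R_def\<close>)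
    also have "(sqrt pi / 2 * (1 / 4) powr r * R) powr (1 / r)
        = (sqrt pi / 2) powr (1 / r) * (1 / 4) * R powr (1 / r)"
    proof -
      have "(x * y * z) powr w = x powr w * y powr w * z powr w"
        if "x \<ge> 0" "y \<ge> 0" "z \<ge> 0" for x y z w :: real
        using that by (simp add: powr_mult)
      from this[of "sqrt pi / 2" "(1 / 4) powr r" R "1 / r"] show ?thesis
        using R r1 by (simp add: powr_powr)
    qed
    also have "\<dots> \<le> 1 * (1 / 4) * R powr (1 / r)"
    proof (intro mult_right_mono)
      have "sqrt pi \<le> 2"
        using pi_less_4 by (intro real_le_lsqrt) auto
      then have "(sqrt pi / 2) powr (1 / r) \<le> 1 powr (1 / r)"
        using r1 by (intro powr_mono2) auto
      then show "(sqrt pi / 2) powr (1 / r) \<le> 1"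
        by simp
    qed auto
    finally show ?thesis
      using finite by (simp add: gamma_ratio_root_def R_def mult_right_mono)
  qed
qed


section \<open>The convexity majorant and the inequality\<close>

lemma rpow_nonneg: "0 \<le> rpow t \<alpha>"
  by (simp add: rpow_def)

lemma rpow_le_one:
  assumes "t \<in> {0..1}" "\<alpha> \<ge> 0"
  shows "rpow t \<alpha> \<le> 1"
  using assms powr_mono2[of \<alpha> t 1] by (auto simp: rpow_def)

lemma has_integral_rpow:
  assumes "\<alpha> \<ge> 0"
  shows "((\<lambda>t. rpow t \<alpha>) has_integral 1 / (\<alpha> + 1)) {0..1}"
proof (cases "\<alpha> = 0")
  case True
  then show ?thesis
    using has_integral_const_real[of "1::real" 0 1] by (simp add: rpow_def)
next
  case False
  then show ?thesis
    using has_integral_powr_from_0[of \<alpha> 1] assms by (simp add: rpow_def)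
qed

theorem theorem4:
  fixes f f' f'' :: "real \<Rightarrow> real"
    and I :: "real set"
    and bstar a b \<alpha> m q :: real
    and p :: ereal
  assumes "bstar > 0"
    and "is_interval I" and "I \<subseteq> {0..bstar}"
    and "a \<in> I" and "b \<in> I" and "a < b"
    and "\<alpha> \<in> {0..1}" and "m \<in> {0..1}"
    and "m * b \<in> I" and "m * b \<noteq> a"
    and "\<And>x. x \<in> interior I \<Longrightarrow> (f has_real_derivative f' x) (at x)"
    and "\<And>x. x \<in> interior I \<Longrightarrow> (f' has_real_derivative f'' x) (at x)"
    and "\<And>x. x \<in> {a, b, m * b} \<Longrightarrow> (f has_real_derivative f' x) (at x within I)"
    and "\<And>x. x \<in> {a, b, m * b} \<Longrightarrow> (f' has_real_derivative f'' x) (at x within I)"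
    and "f'' absolutely_integrable_on {a..b}"
    and "q \<ge> 1" and "p \<ge> 1" and "1 / p + 1 / ereal q = 1"
    and "alpha_m_convex_on \<alpha> m {a..b} (\<lambda>x. \<bar>f'' x\<bar> powr q)"
  shows "\<bar>(f a + f (m * b)) / 2 - 1 / (m * b - a) * (LBINT x=a..m * b. f x)\<bar>
    \<le> (m * b - a)\<^sup>2 / 8 * gamma_ratio_root p *
        (\<bar>f'' a\<bar> powr q * (1 / (\<alpha> + 1)) + m * \<bar>f'' b\<bar> powr q * (\<alpha> / (\<alpha> + 1))) powr (1 / q)"
proof -
  define c where "c = m * b"
  let ?S = "closed_segment a c"
  have ac: "a \<noteq> c" and cI: "c \<in> I"
    using assms(9,10) by (auto simp: c_def)
  have S: "?S = {min a c..max a c}"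
    by (simp add: closed_segment_eq_real_ivl min_def max_def)
  have SI: "?S \<subseteq> I"
    using assms(2,4) cI by (simp add: closed_segment_subset is_interval_convex)
  have within: "(g has_real_derivative g' x) (at x within ?S)"
    if int: "\<And>x. x \<in> interior I \<Longrightarrow> (g has_real_derivative g' x) (at x)"
      and ends: "\<And>x. x \<in> {a, b, m * b} \<Longrightarrow> (g has_real_derivative g' x) (at x within I)"
      and x: "x \<in> ?S" for g g' :: "real \<Rightarrow> real" and x
  proof (cases "x \<in> {a, c}")
    case True
    then have "x \<in> {a, b, m * b}"
      by (auto simp: c_def)
    from DERIV_subset[OF ends[OF this] SI] show ?thesis .
  next
    case False
    then have "x \<in> {min a c<..<max a c}"
      using x S by auto
    moreover have "{min a c<..<max a c} \<subseteq> I"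
      using SI unfolding S by force
    ultimately have "x \<in> interior I"
      by (intro interiorI[OF open_greaterThanLessThan])
    from has_field_derivative_at_within[OF int[OF this]] show ?thesis .
  qed
  define T where "T = (f a + f c) / 2 - 1 / (c - a) * (LBINT x=a..c. f x)"
  have K: "((\<lambda>t. t * (1 - t) * f'' (t * a + (1 - t) * c)) has_integral 2 / (c - a)\<^sup>2 * T) {0..1}"
  proof -
    have "(f has_real_derivative f' x) (at x within ?S)"
      and "(f' has_real_derivative f'' x) (at x within ?S)" if "x \<in> ?S" for x
      by (rule within[OF assms(11) assms(13) that] within[OF assms(12) assms(14) that];
          assumption)+
    then show ?thesis
      unfolding T_def by (rule has_integral_trapezoid_error[OF ac])
  qed
  define A where "A = \<bar>f'' a\<bar> powr q"
  define B where "B = \<bar>f'' b\<bar> powr q"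
  define \<phi> where "\<phi> = (\<lambda>t. rpow t \<alpha> * A + m * (1 - rpow t \<alpha>) * B)"
  define \<Phi> where "\<Phi> = A * (1 / (\<alpha> + 1)) + m * B * (\<alpha> / (\<alpha> + 1))"
  have \<alpha>: "\<alpha> \<ge> 0" and m: "m \<ge> 0"
    using assms(7,8) by auto
  have \<phi>0: "\<phi> t \<ge> 0" if "t \<in> {0..1}" for t
    using rpow_nonneg[of t \<alpha>] rpow_le_one[OF that \<alpha>] m by (simp add: \<phi>_def A_def B_def)
  have \<Phi>: "(\<phi> has_integral \<Phi>) {0..1}"
  proof -
    have one: "((\<lambda>t. 1::real) has_integral 1) {0..1::real}"
      using has_integral_const_real[of "1::real" 0 1] by simp
    have "(\<phi> has_integral 1 / (\<alpha> + 1) * A + m * (1 - 1 / (\<alpha> + 1)) * B) {0..1}"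
      unfolding \<phi>_def
      by (intro has_integral_add has_integral_mult_left has_integral_mult_right has_integral_diff
          has_integral_rpow one \<alpha>)
    moreover have "1 - 1 / (\<alpha> + 1) = \<alpha> / (\<alpha> + 1)"
      using \<alpha> by (simp add: field_simps)
    ultimately show ?thesis
      by (simp add: \<Phi>_def mult_ac)
  qed
  have k: "\<bar>t * (1 - t) * f'' (t * a + (1 - t) * c)\<bar> \<le> t * (1 - t) * \<phi> t powr (1 / q)"
    if t: "t \<in> {0..1}" for t
  proof -
    let ?x = "t * a + (1 - t) * c"
    have "\<bar>f'' ?x\<bar> powr q \<le> \<phi> t"
    proof -
      have ab: "a \<in> {a..b}" "b \<in> {a..b}"
        using \<open>a < b\<close> by auto
      have "\<bar>f'' (t * a + m * (1 - t) * b)\<bar> powr q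
          \<le> rpow t \<alpha> * \<bar>f'' a\<bar> powr q + m * (1 - rpow t \<alpha>) * \<bar>f'' b\<bar> powr q"
        using assms(19)[unfolded alpha_m_convex_on_def, rule_format, OF ab t] .
      moreover have "t * a + m * (1 - t) * b = ?x"
        by (simp add: c_def)
      ultimately show ?thesis
        by (simp only: \<phi>_def A_def B_def)
    qed
    then have "(\<bar>f'' ?x\<bar> powr q) powr (1 / q) \<le> \<phi> t powr (1 / q)"
      using assms(16) by (intro powr_mono2) auto
    then have "\<bar>f'' ?x\<bar> \<le> \<phi> t powr (1 / q)"
      using assms(16) by (simp add: powr_powr)
    then show ?thesis
      using t by (simp add: abs_mult mult_left_mono)
  qed
  have "\<bar>2 / (c - a)\<^sup>2 * T\<bar> \<le> 1 / 4 * gamma_ratio_root p * \<Phi> powr (1 / q)"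
    using quadratic_weight_Holder_bound[OF assms(16,17,18) \<phi>0 \<Phi> K k] .
  then have "\<bar>T\<bar> \<le> (c - a)\<^sup>2 / 8 * gamma_ratio_root p * \<Phi> powr (1 / q)"
    using ac by (simp add: abs_mult field_simps)
  then show ?thesis
    unfolding T_def \<Phi>_def A_def B_def c_def .
qed

end
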